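(* Let $\alpha=(\alpha_i)_{i\in\mathbb{N}}$ be a sequence of real numbers with $\alpha_i>0$ for all $i$, and assume that $\alpha$ converges. Let $W_\alpha$ be the associated unilateral weighted shift. Then $$\ell(W_\alpha)=r(W_\alpha)=\lim_{i\to\infty}\alpha_i,$$ where $r$ denotes the spectral radius and $\ell$ the mean limit.
   Context: Here $\mathbb{N}=\{0,1,2,\dots\}$ and $\ell^2(\mathbb{N})$ is the Hilbert space of complex square-summable sequences. For a bounded sequence $\alpha=(\alpha_i)_{i\in\mathbb{N}}$ of strictly positive numbers, the unilateral weighted shift $W_\alpha:\ell^2(\mathbb{N})\to\ell^2(\mathbb{N})$ is $W_\alpha(x_0,x_1,\dots):=(0,\alpha_0x_0,\alpha_1x_1,\dots)$. For a bounded operator $T$ on a Hilbert space, $|T|:=(T^*T)^{1/2}$, and the canonical polar decomposition is $T=V|T|$ where $V$ is the partial isometry with null space $\mathcal{N}(V)=\mathcal{N}(T)$. The mean transform of $T$ is $\widehat{T}:=\frac12(V|T|+|T|V)$. Its iterates are $\widehat{T}^{(0)}:=T$ and $\widehat{T}^{(n+1)}:=\widehat{\widehat{T}^{(n)}}$, i.e. the mean transform of $\widehat{T}^{(n)}$. The sequence $(\|\widehat{T}^{(n)}\|)_{n\in\mathbb{N}}$ is non-increasing, and the mean limit of $T$ is $\ell(T):=\lim_{n\to\infty}\|\widehat{T}^{(n)}\|=\inf_{n}\|\widehat{T}^{(n)}\|$. *)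

theory Defs
  imports "HOL-Analysis.Analysis"
begin

section \<open>Complex Hilbert spaces\<close>

text \<open>
  The inner product of a complex space is linear in the first argument. The real inner product
  (hence norm and topology) of the underlying real space is its real part.
\<close>

class complex_inner = real_inner +
  fixes scaleC :: "complex \<Rightarrow> 'a \<Rightarrow> 'a" (infixr "*\<^sub>C" 75)
    and cinner :: "'a \<Rightarrow> 'a \<Rightarrow> complex"
  assumes scaleC_add_right: "c *\<^sub>C (x + y) = c *\<^sub>C x + c *\<^sub>C y"
    and scaleC_add_left: "(c + d) *\<^sub>C x = c *\<^sub>C x + d *\<^sub>C x"
    and scaleC_scaleC: "c *\<^sub>C d *\<^sub>C x = (c * d) *\<^sub>C x"
    and scaleC_of_real: "complex_of_real r *\<^sub>C x = r *\<^sub>R x"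
    and cinner_commute: "cinner x y = cnj (cinner y x)"
    and cinner_add_left: "cinner (x + y) z = cinner x z + cinner y z"
    and cinner_scaleC_left: "cinner (c *\<^sub>C x) y = c * cinner x y"
    and inner_eq_Re_cinner: "inner x y = Re (cinner x y)"

class complex_hilbert = complex_inner + banach

lemma cinner_self: "cinner x x = complex_of_real ((norm (x :: 'a :: complex_inner))\<^sup>2)"
proof -
  have "Im (cinner x x) = 0"
    using arg_cong [OF cinner_commute [of x x], of Im] by simp
  then show ?thesis
    by (simp add: complex_eq_iff power2_norm_eq_inner inner_eq_Re_cinner)
qed

lemma norm_scaleC: "norm (c *\<^sub>C x) = cmod c * norm (x :: 'a :: complex_inner)"
proof -
  have "cinner (c *\<^sub>C x) (c *\<^sub>C x) = c * cnj c * cinner x x"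
    by (metis cinner_commute cinner_scaleC_left complex_cnj_mult mult.assoc)
  then have "complex_of_real ((norm (c *\<^sub>C x))\<^sup>2) = complex_of_real ((cmod c * norm x)\<^sup>2)"
    by (simp only: cinner_self complex_norm_square [symmetric] power_mult_distrib of_real_mult)
  then have "(norm (c *\<^sub>C x))\<^sup>2 = (cmod c * norm x)\<^sup>2"
    by (simp only: of_real_eq_iff)
  then show ?thesis
    by (simp add: power2_eq_iff_nonneg)
qed

lemma bounded_linear_scaleC: "bounded_linear (\<lambda>x :: 'a :: complex_inner. c *\<^sub>C x)"
proof (rule bounded_linear_intro [where K = "cmod c"])
  show "c *\<^sub>C (r *\<^sub>R x) = r *\<^sub>R (c *\<^sub>C x)" for r and x :: 'a
    by (metis scaleC_of_real scaleC_scaleC mult.commute)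
qed (simp_all add: scaleC_add_right norm_scaleC mult.commute)


section \<open>Bounded operators\<close>

text \<open>
  The type \<open>'a \<Rightarrow>\<^sub>L 'a\<close> consists of all real-linear bounded maps, with the operator norm. The
  bounded operators of a complex space are its complex-linear elements. Adjoint, positive square
  root and partial-isometry factor are given by definite description; on a Hilbert space each of
  them exists and is unique (for complex-linear arguments, positive in the case of the root).
\<close>

definition complex_linear :: "('a :: complex_inner \<Rightarrow>\<^sub>L 'a) \<Rightarrow> bool"
  where "complex_linear T \<longleftrightarrow> (\<forall>c x. blinfun_apply T (c *\<^sub>C x) = c *\<^sub>C blinfun_apply T x)"

definition op_adjoint :: "('a :: complex_hilbert \<Rightarrow>\<^sub>L 'a) \<Rightarrow> ('a \<Rightarrow>\<^sub>L 'a)"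
  where "op_adjoint T = (THE S. complex_linear S \<and>
    (\<forall>x y. cinner (blinfun_apply T x) y = cinner x (blinfun_apply S y)))"

definition positive_op :: "('a :: complex_hilbert \<Rightarrow>\<^sub>L 'a) \<Rightarrow> bool"
  where "positive_op P \<longleftrightarrow> complex_linear P \<and> (\<forall>x. cinner (blinfun_apply P x) x \<in> \<real>\<^sub>\<ge>\<^sub>0)"

definition op_sqrt :: "('a :: complex_hilbert \<Rightarrow>\<^sub>L 'a) \<Rightarrow> ('a \<Rightarrow>\<^sub>L 'a)"
  where "op_sqrt A = (THE P. positive_op P \<and> P o\<^sub>L P = A)"

definition op_abs :: "('a :: complex_hilbert \<Rightarrow>\<^sub>L 'a) \<Rightarrow> ('a \<Rightarrow>\<^sub>L 'a)"
  where "op_abs T = op_sqrt (op_adjoint T o\<^sub>L T)"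

definition null_space :: "('a :: complex_hilbert \<Rightarrow>\<^sub>L 'a) \<Rightarrow> 'a set"
  where "null_space T = {x. blinfun_apply T x = 0}"

definition partial_isometry :: "('a :: complex_hilbert \<Rightarrow>\<^sub>L 'a) \<Rightarrow> bool"
  where "partial_isometry V \<longleftrightarrow> complex_linear V \<and>
    (\<forall>x. (\<forall>y \<in> null_space V. cinner x y = 0) \<longrightarrow> norm (blinfun_apply V x) = norm x)"

definition polar_factor :: "('a :: complex_hilbert \<Rightarrow>\<^sub>L 'a) \<Rightarrow> ('a \<Rightarrow>\<^sub>L 'a)"
  where "polar_factor T = (THE V. partial_isometry V \<and> null_space V = null_space T \<and>
    T = V o\<^sub>L op_abs T)"

definition mean_transform :: "('a :: complex_hilbert \<Rightarrow>\<^sub>L 'a) \<Rightarrow> ('a \<Rightarrow>\<^sub>L 'a)"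
  where "mean_transform T =
    (1 / 2) *\<^sub>R ((polar_factor T o\<^sub>L op_abs T) + (op_abs T o\<^sub>L polar_factor T))"

definition mean_limit :: "('a :: complex_hilbert \<Rightarrow>\<^sub>L 'a) \<Rightarrow> real"
  where "mean_limit T = lim (\<lambda>n. norm ((mean_transform ^^ n) T))"

lift_definition scalar_op :: "complex \<Rightarrow> ('a :: complex_hilbert \<Rightarrow>\<^sub>L 'a)" is "\<lambda>c x. c *\<^sub>C x"
  by (rule bounded_linear_scaleC)

definition op_invertible :: "('a :: complex_hilbert \<Rightarrow>\<^sub>L 'a) \<Rightarrow> bool"
  where "op_invertible T \<longleftrightarrow>
    (\<exists>S. complex_linear S \<and> S o\<^sub>L T = id_blinfun \<and> T o\<^sub>L S = id_blinfun)"

definition op_spectrum :: "('a :: complex_hilbert \<Rightarrow>\<^sub>L 'a) \<Rightarrow> complex set"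
  where "op_spectrum T = {c. \<not> op_invertible (T - scalar_op c)}"

definition op_spectral_radius :: "('a :: complex_hilbert \<Rightarrow>\<^sub>L 'a) \<Rightarrow> real"
  where "op_spectral_radius T = (SUP c \<in> op_spectrum T. cmod c)"


section \<open>The space of complex square-summable sequences\<close>

typedef ell2 = "{x :: nat \<Rightarrow> complex. summable (\<lambda>i. (cmod (x i))\<^sup>2)}"
  morphisms ell2_nth Abs_ell2
  by (rule exI [of _ "\<lambda>_. 0"]) simp

setup_lifting type_definition_ell2

lemma square_summable_add:
  fixes x y :: "nat \<Rightarrow> complex"
  assumes "summable (\<lambda>i. (cmod (x i))\<^sup>2)" "summable (\<lambda>i. (cmod (y i))\<^sup>2)"
  shows "summable (\<lambda>i. (cmod (x i + y i))\<^sup>2)"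
proof (rule summable_comparison_test')
  show "summable (\<lambda>i. 2 * (cmod (x i))\<^sup>2 + 2 * (cmod (y i))\<^sup>2)"
    using assms by (intro summable_add summable_mult)
  fix i
  have "(cmod (x i + y i))\<^sup>2 \<le> (cmod (x i) + cmod (y i))\<^sup>2"
    by (intro power_mono norm_triangle_ineq) simp
  also have "\<dots> \<le> 2 * (cmod (x i))\<^sup>2 + 2 * (cmod (y i))\<^sup>2"
    using sum_squares_bound [of "cmod (x i)" "cmod (y i)"] by (simp add: power2_sum)
  finally show "norm ((cmod (x i + y i))\<^sup>2) \<le> 2 * (cmod (x i))\<^sup>2 + 2 * (cmod (y i))\<^sup>2"
    by simp
qed

lemma square_summable_mult:
  fixes x :: "nat \<Rightarrow> complex"
  assumes "summable (\<lambda>i. (cmod (x i))\<^sup>2)"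
  shows "summable (\<lambda>i. (cmod (c * x i))\<^sup>2)"
  using summable_mult [OF assms, of "(cmod c)\<^sup>2"] by (simp add: norm_mult power_mult_distrib)

lemma square_summable_prod:
  fixes x y :: "nat \<Rightarrow> complex"
  assumes "summable (\<lambda>i. (cmod (x i))\<^sup>2)" "summable (\<lambda>i. (cmod (y i))\<^sup>2)"
  shows "summable (\<lambda>i. x i * cnj (y i))"
proof (rule summable_comparison_test')
  show "summable (\<lambda>i. (cmod (x i))\<^sup>2 + (cmod (y i))\<^sup>2)"
    using assms by (intro summable_add)
  fix i
  have "2 * cmod (x i) * cmod (y i) \<le> (cmod (x i))\<^sup>2 + (cmod (y i))\<^sup>2"
    by (rule sum_squares_bound)
  moreover have "0 \<le> cmod (x i) * cmod (y i)"
    by simp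
  ultimately have "cmod (x i) * cmod (y i) \<le> (cmod (x i))\<^sup>2 + (cmod (y i))\<^sup>2"
    by linarith
  then show "norm (x i * cnj (y i)) \<le> (cmod (x i))\<^sup>2 + (cmod (y i))\<^sup>2"
    by (simp add: norm_mult)
qed

instantiation ell2 :: complex_inner
begin

lift_definition zero_ell2 :: ell2 is "\<lambda>_. 0" by simp
lift_definition plus_ell2 :: "ell2 \<Rightarrow> ell2 \<Rightarrow> ell2" is "\<lambda>x y i. x i + y i"
  by (rule square_summable_add)
lift_definition uminus_ell2 :: "ell2 \<Rightarrow> ell2" is "\<lambda>x i. - x i" by simp
lift_definition minus_ell2 :: "ell2 \<Rightarrow> ell2 \<Rightarrow> ell2" is "\<lambda>x y i. x i - y i"
  using square_summable_add [where y = "\<lambda>i. - y i" for y] by simp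
lift_definition scaleC_ell2 :: "complex \<Rightarrow> ell2 \<Rightarrow> ell2" is "\<lambda>c x i. c * x i"
  by (rule square_summable_mult)
lift_definition scaleR_ell2 :: "real \<Rightarrow> ell2 \<Rightarrow> ell2" is "\<lambda>r x i. complex_of_real r * x i"
  by (rule square_summable_mult)
lift_definition cinner_ell2 :: "ell2 \<Rightarrow> ell2 \<Rightarrow> complex" is "\<lambda>x y. \<Sum>i. x i * cnj (y i)" .

definition inner_ell2 :: "ell2 \<Rightarrow> ell2 \<Rightarrow> real"
  where "inner_ell2 x y = Re (cinner x y)"
definition norm_ell2 :: "ell2 \<Rightarrow> real"
  where "norm_ell2 x = sqrt (inner x x)"
definition dist_ell2 :: "ell2 \<Rightarrow> ell2 \<Rightarrow> real"
  where "dist_ell2 x y = norm (x - y)"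
definition sgn_ell2 :: "ell2 \<Rightarrow> ell2"
  where "sgn_ell2 x = inverse (norm x) *\<^sub>R x"
definition uniformity_ell2 :: "(ell2 \<times> ell2) filter"
  where "uniformity_ell2 = (INF e\<in>{0<..}. principal {(x, y). dist x y < e})"
definition open_ell2 :: "ell2 set \<Rightarrow> bool"
  where "open_ell2 U \<longleftrightarrow> (\<forall>x\<in>U. eventually (\<lambda>(x', y). x' = x \<longrightarrow> y \<in> U) uniformity)"

instance
proof
  fix x y z :: ell2 and a b :: real and c d :: complex
  show "x + y + z = x + (y + z)" by transfer (simp add: add.assoc)
  show "x + y = y + x" by transfer (simp add: add.commute)
  show "0 + x = x" by transfer simp
  show "- x + x = 0" by transfer simp
  show "x - y = x + - y" by transfer simp
  show "a *\<^sub>R (x + y) = a *\<^sub>R x + a *\<^sub>R y" by transfer (simp add: distrib_left)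
  show "(a + b) *\<^sub>R x = a *\<^sub>R x + b *\<^sub>R x" by transfer (simp add: distrib_right)
  show "a *\<^sub>R b *\<^sub>R x = (a * b) *\<^sub>R x" by transfer (simp add: mult.assoc)
  show "1 *\<^sub>R x = x" by transfer simp
  show "dist x y = norm (x - y)" by (rule dist_ell2_def)
  show "sgn x = inverse (norm x) *\<^sub>R x" by (rule sgn_ell2_def)
  show "uniformity = (INF e\<in>{0<..}. principal {(x, y :: ell2). dist x y < e})"
    by (rule uniformity_ell2_def)
  show "open U \<longleftrightarrow> (\<forall>x\<in>U. eventually (\<lambda>(x', y). x' = x \<longrightarrow> y \<in> U) uniformity)"
    for U :: "ell2 set"
    by (rule open_ell2_def)
  show "c *\<^sub>C (x + y) = c *\<^sub>C x + c *\<^sub>C y" by transfer (simp add: distrib_left)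
  show "(c + d) *\<^sub>C x = c *\<^sub>C x + d *\<^sub>C x" by transfer (simp add: distrib_right)
  show "c *\<^sub>C d *\<^sub>C x = (c * d) *\<^sub>C x" by transfer (simp add: mult.assoc)
  show "complex_of_real a *\<^sub>C x = a *\<^sub>R x" by transfer simp
  show commute: "cinner x y = cnj (cinner y x)" for x y :: ell2
  proof transfer
    fix x y :: "nat \<Rightarrow> complex"
    assume "summable (\<lambda>i. (cmod (x i))\<^sup>2)" "summable (\<lambda>i. (cmod (y i))\<^sup>2)"
    then have "(\<lambda>i. y i * cnj (x i)) sums (\<Sum>i. y i * cnj (x i))"
      by (intro summable_sums square_summable_prod)
    then have "(\<lambda>i. cnj (y i * cnj (x i))) sums cnj (\<Sum>i. y i * cnj (x i))"
      by (simp only: sums_cnj)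
    then show "(\<Sum>i. x i * cnj (y i)) = cnj (\<Sum>i. y i * cnj (x i))"
      by (simp add: sums_iff mult.commute)
  qed
  show add: "cinner (x + y) z = cinner x z + cinner y z"
    by transfer (simp add: distrib_right suminf_add square_summable_prod)
  show scale: "cinner (c *\<^sub>C x) y = c * cinner x y" for c
    by transfer (simp add: mult.assoc suminf_mult square_summable_prod)
  show "inner x y = Re (cinner x y)" by (rule inner_ell2_def)
  show "inner x y = inner y x"
    using commute [of x y] by (simp add: inner_ell2_def)
  show "inner (x + y) z = inner x z + inner y z"
    by (simp add: inner_ell2_def add)
  have "a *\<^sub>R x = complex_of_real a *\<^sub>C x" by transfer simp
  then show "inner (a *\<^sub>R x) y = a * inner x y"
    by (simp add: inner_ell2_def scale)
  have inner_self: "summable (\<lambda>i. (cmod (ell2_nth x i))\<^sup>2)"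
    "inner x x = (\<Sum>i. (cmod (ell2_nth x i))\<^sup>2)"
  proof -
    show summ: "summable (\<lambda>i. (cmod (ell2_nth x i))\<^sup>2)"
      using ell2_nth [of x] by simp
    have "(\<lambda>i. complex_of_real ((cmod (ell2_nth x i))\<^sup>2)) sums
        complex_of_real (\<Sum>i. (cmod (ell2_nth x i))\<^sup>2)"
      by (intro sums_of_real summable_sums summ)
    then have "cinner x x = complex_of_real (\<Sum>i. (cmod (ell2_nth x i))\<^sup>2)"
      unfolding cinner_ell2.rep_eq complex_norm_square by (rule sums_unique [symmetric])
    then show "inner x x = (\<Sum>i. (cmod (ell2_nth x i))\<^sup>2)"
      by (simp only: inner_ell2_def Re_complex_of_real)
  qed
  show "0 \<le> inner x x"
    by (simp add: inner_self suminf_nonneg)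
  show "inner x x = 0 \<longleftrightarrow> x = 0"
    using suminf_eq_zero_iff [OF inner_self(1)]
    by (auto simp: inner_self(2) ell2_nth_inject [symmetric] zero_ell2.rep_eq fun_eq_iff)
  show "norm x = sqrt (inner x x)" by (rule norm_ell2_def)
qed

end

lemma summable_ell2: "summable (\<lambda>i. (cmod (ell2_nth x i))\<^sup>2)"
  using ell2_nth [of x] by simp

lemma norm_ell2_square: "(norm x)\<^sup>2 = (\<Sum>i. (cmod (ell2_nth x i))\<^sup>2)"
proof -
  have "(\<lambda>i. complex_of_real ((cmod (ell2_nth x i))\<^sup>2)) sums
      complex_of_real (\<Sum>i. (cmod (ell2_nth x i))\<^sup>2)"
    by (intro sums_of_real summable_sums summable_ell2)
  then have "cinner x x = complex_of_real (\<Sum>i. (cmod (ell2_nth x i))\<^sup>2)"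
    unfolding cinner_ell2.rep_eq complex_norm_square by (rule sums_unique [symmetric])
  then show ?thesis
    by (simp only: cinner_self of_real_eq_iff)
qed

lemma sum_le_norm_ell2: "(\<Sum>i<k. (cmod (ell2_nth x i))\<^sup>2) \<le> (norm x)\<^sup>2"
  unfolding norm_ell2_square by (rule sum_le_suminf [OF summable_ell2]) auto

lemma cmod_ell2_nth_le: "cmod (ell2_nth x i) \<le> norm x"
proof -
  have "(cmod (ell2_nth x i))\<^sup>2 \<le> (\<Sum>j<Suc i. (cmod (ell2_nth x j))\<^sup>2)"
    by (simp add: sum_nonneg)
  also have "\<dots> \<le> (norm x)\<^sup>2"
    by (rule sum_le_norm_ell2)
  finally show ?thesis
    by (rule power2_le_imp_le) simp
qed

instance ell2 :: complex_hilbert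
proof
  fix X :: "nat \<Rightarrow> ell2"
  assume X: "Cauchy X"
  have "Cauchy (\<lambda>n. ell2_nth (X n) i)" for i
  proof (rule metric_CauchyI)
    fix e :: real
    assume "e > 0"
    then obtain M where M: "\<And>m n. m \<ge> M \<Longrightarrow> n \<ge> M \<Longrightarrow> dist (X m) (X n) < e"
      using metric_CauchyD [OF X] by blast
    have "dist (ell2_nth (X m) i) (ell2_nth (X n) i) \<le> dist (X m) (X n)" for m n
      using cmod_ell2_nth_le [of "X m - X n" i] by (simp add: dist_norm minus_ell2.rep_eq)
    then show "\<exists>M. \<forall>m\<ge>M. \<forall>n\<ge>M. dist (ell2_nth (X m) i) (ell2_nth (X n) i) < e"
      using M by (meson order_le_less_trans)
  qed
  then have "\<forall>i. \<exists>l. (\<lambda>n. ell2_nth (X n) i) \<longlonglongrightarrow> l"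
    by (simp add: Cauchy_convergent_iff convergent_def)
  then obtain l where l: "\<And>i. (\<lambda>n. ell2_nth (X n) i) \<longlonglongrightarrow> l i"
    by metis
  have bound: "(\<Sum>i<k. (cmod (ell2_nth (X m) i - l i))\<^sup>2) \<le> e\<^sup>2"
    if M: "\<And>m n. m \<ge> M \<Longrightarrow> n \<ge> M \<Longrightarrow> dist (X m) (X n) < e" and "m \<ge> M" for M m k e
  proof (rule LIMSEQ_le_const2)
    show "(\<lambda>n. \<Sum>i<k. (cmod (ell2_nth (X m) i - ell2_nth (X n) i))\<^sup>2)
        \<longlonglongrightarrow> (\<Sum>i<k. (cmod (ell2_nth (X m) i - l i))\<^sup>2)"
      by (intro tendsto_intros l)
    have "(\<Sum>i<k. (cmod (ell2_nth (X m) i - ell2_nth (X n) i))\<^sup>2) \<le> e\<^sup>2" if "n \<ge> M" for n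
    proof -
      have "(\<Sum>i<k. (cmod (ell2_nth (X m) i - ell2_nth (X n) i))\<^sup>2) \<le> (norm (X m - X n))\<^sup>2"
        using sum_le_norm_ell2 [of "X m - X n" k] by (simp add: minus_ell2.rep_eq)
      also have "\<dots> \<le> e\<^sup>2"
        using M [OF \<open>m \<ge> M\<close> that] by (intro power_mono) (auto simp: dist_norm)
      finally show ?thesis .
    qed
    then show "\<exists>N. \<forall>n\<ge>N. (\<Sum>i<k. (cmod (ell2_nth (X m) i - ell2_nth (X n) i))\<^sup>2) \<le> e\<^sup>2"
      by blast
  qed
  have summ: "summable (\<lambda>i. (cmod (ell2_nth (X m) i - l i))\<^sup>2)"
    if M: "\<And>m n. m \<ge> M \<Longrightarrow> n \<ge> M \<Longrightarrow> dist (X m) (X n) < e" and "m \<ge> M" for M m e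
    by (rule bounded_imp_summable [where B = "e\<^sup>2"])
      (use bound [OF M \<open>m \<ge> M\<close>, of "Suc k" for k] in \<open>auto simp: lessThan_Suc_atMost\<close>)
  obtain M where M: "\<And>m n. m \<ge> M \<Longrightarrow> n \<ge> M \<Longrightarrow> dist (X m) (X n) < 1"
    using metric_CauchyD [OF X, of 1] by auto
  have "summable (\<lambda>i. (cmod (- 1 * (ell2_nth (X M) i - l i) + ell2_nth (X M) i))\<^sup>2)"
    by (intro square_summable_add square_summable_mult summable_ell2 summ [OF M order_refl])
  then have "summable (\<lambda>i. (cmod (l i))\<^sup>2)"
    by simp
  then obtain L where L: "ell2_nth L = l"
    using Abs_ell2_inverse [of l] by auto
  have "X \<longlonglongrightarrow> L"
  proof (rule metric_LIMSEQ_I)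
    fix e :: real
    assume "e > 0"
    then obtain M where M: "\<And>m n. m \<ge> M \<Longrightarrow> n \<ge> M \<Longrightarrow> dist (X m) (X n) < e / 2"
      using metric_CauchyD [OF X, of "e / 2"] by auto
    have "dist (X m) L < e" if "m \<ge> M" for m
    proof -
      have "(norm (X m - L))\<^sup>2 \<le> (e / 2)\<^sup>2"
        unfolding norm_ell2_square minus_ell2.rep_eq L
        by (intro suminf_le_const summ [OF M that] bound [OF M that])
      then have "norm (X m - L) \<le> e / 2"
        by (rule power2_le_imp_le) (use \<open>e > 0\<close> in simp)
      then show ?thesis
        using \<open>e > 0\<close> by (simp add: dist_norm)
    qed
    then show "\<exists>no. \<forall>n\<ge>no. dist (X n) L < e"
      by blast
  qed
  then show "convergent X"
    by (auto simp: convergent_def)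
qed


section \<open>Unilateral weighted shifts\<close>

definition shift_seq :: "(nat \<Rightarrow> real) \<Rightarrow> (nat \<Rightarrow> complex) \<Rightarrow> nat \<Rightarrow> complex"
  where "shift_seq \<alpha> x n = (case n of 0 \<Rightarrow> 0 | Suc i \<Rightarrow> complex_of_real (\<alpha> i) * x i)"

text \<open>Meaningful for bounded weight sequences; see \<open>weighted_shift_nth\<close>.\<close>

definition weighted_shift :: "(nat \<Rightarrow> real) \<Rightarrow> (ell2 \<Rightarrow>\<^sub>L ell2)"
  where "weighted_shift \<alpha> = Blinfun (\<lambda>x. Abs_ell2 (shift_seq \<alpha> (ell2_nth x)))"

lemma
  assumes "bounded (range \<alpha>)"
  shows weighted_shift_nth:
      "ell2_nth (blinfun_apply (weighted_shift \<alpha>) x) = shift_seq \<alpha> (ell2_nth x)"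
    and complex_linear_weighted_shift: "complex_linear (weighted_shift \<alpha>)"
proof -
  let ?f = "\<lambda>x. Abs_ell2 (shift_seq \<alpha> (ell2_nth x))"
  obtain B where B: "\<And>i. \<bar>\<alpha> i\<bar> \<le> B"
    using assms by (auto simp: bounded_iff)
  have "0 \<le> B"
    using B [of 0] by linarith
  have le: "(cmod (shift_seq \<alpha> (ell2_nth x) (Suc i)))\<^sup>2 \<le> B\<^sup>2 * (cmod (ell2_nth x i))\<^sup>2" for x i
  proof -
    have "(\<bar>\<alpha> i\<bar> * cmod (ell2_nth x i))\<^sup>2 \<le> (B * cmod (ell2_nth x i))\<^sup>2"
      by (intro power_mono mult_right_mono B) auto
    then show ?thesis
      by (simp add: shift_seq_def norm_mult power_mult_distrib)
  qed
  have summ': "summable (\<lambda>i. (cmod (shift_seq \<alpha> (ell2_nth x) (Suc i)))\<^sup>2)" for x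
    by (rule summable_comparison_test' [OF summable_mult [OF summable_ell2 [of x], of "B\<^sup>2"]])
      (use le [of x] in simp)
  then have summ: "summable (\<lambda>i. (cmod (shift_seq \<alpha> (ell2_nth x) i))\<^sup>2)" for x
    by (subst (asm) summable_Suc_iff)
  have nth: "ell2_nth (?f x) = shift_seq \<alpha> (ell2_nth x)" for x
    using summ by (simp add: Abs_ell2_inverse)
  have "bounded_linear ?f"
  proof (rule bounded_linear_intro [where K = B])
    show "?f (x + y) = ?f x + ?f y" for x y
      unfolding ell2_nth_inject [symmetric] nth unfolding plus_ell2.rep_eq nth
      by (auto simp: shift_seq_def fun_eq_iff distrib_left split: nat.split)
    show "?f (r *\<^sub>R x) = r *\<^sub>R ?f x" for r x
      unfolding ell2_nth_inject [symmetric] nth unfolding scaleR_ell2.rep_eq nth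
      by (auto simp: shift_seq_def fun_eq_iff split: nat.split)
    fix x
    have "(norm (?f x))\<^sup>2 = (\<Sum>i. (cmod (shift_seq \<alpha> (ell2_nth x) (Suc i)))\<^sup>2)"
      unfolding norm_ell2_square nth
      by (subst suminf_split_head [OF summ]) (simp add: shift_seq_def)
    also have "\<dots> \<le> (\<Sum>i. B\<^sup>2 * (cmod (ell2_nth x i))\<^sup>2)"
      by (intro suminf_le le summ' summable_mult summable_ell2)
    also have "\<dots> = (norm x * B)\<^sup>2"
      by (simp add: suminf_mult summable_ell2 norm_ell2_square power_mult_distrib)
    finally show "norm (?f x) \<le> norm x * B"
      by (rule power2_le_imp_le) (simp add: \<open>0 \<le> B\<close>)
  qed
  then have ap: "blinfun_apply (weighted_shift \<alpha>) = ?f"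
    unfolding weighted_shift_def by (rule bounded_linear_Blinfun_apply)
  show "ell2_nth (blinfun_apply (weighted_shift \<alpha>) x) = shift_seq \<alpha> (ell2_nth x)"
    by (simp only: ap nth)
  show "complex_linear (weighted_shift \<alpha>)"
    unfolding complex_linear_def ap ell2_nth_inject [symmetric] nth
    unfolding scaleC_ell2.rep_eq nth
    by (auto simp: shift_seq_def fun_eq_iff split: nat.split)
qed

end

theory Submission
  imports Defs
begin

text \<open>
  For positive weights the polar decomposition is \<open>W\<^sub>\<alpha> = S D\<^sub>\<alpha>\<close> with \<open>S\<close> the unweighted shift and
  \<open>D\<^sub>\<alpha>\<close> diagonal, so the mean transform of \<open>W\<^sub>\<alpha>\<close> is the shift with weights
  \<open>(\<alpha> i + \<alpha> (Suc i)) / 2\<close>. If \<open>\<alpha>\<close> tends to \<open>L\<close> then \<open>\<alpha> i \<le> L + \<epsilon> + C (1/2)^i\<close> for some \<open>C\<close>, and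
  since averaging multiplies \<open>(1/2)^i\<close> by \<open>3/4\<close>, the weights of the \<open>n\<close>-th iterate are at most
  \<open>L + \<epsilon> + C (3/4)^n\<close>; they still tend to \<open>L\<close>, so the norms converge to \<open>L\<close>.
  For the spectrum: if \<open>|c| < L\<close> or \<open>c = 0\<close>, the first unit vector is not in the range of
  \<open>W\<^sub>\<alpha> - c\<close>, while for \<open>|c| > L\<close> the shift is similar to one of norm less than \<open>|c|\<close>.
\<close>

section \<open>Complex inner product spaces and invertibility\<close>

lemma cinner_diff_left: "cinner (x - y) z = cinner x z - cinner (y :: 'a :: complex_inner) z"
  using cinner_add_left [of "x - y" y z] by simp

lemma cinner_left_eqI:
  fixes x y :: "'a :: complex_inner"
  assumes "\<And>z. cinner z x = cinner z y"
  shows "x = y"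
proof -
  have "cinner x z = cinner y z" for z
    using assms [of z] by (metis cinner_commute)
  then have "cinner (x - y) (x - y) = 0"
    by (simp add: cinner_diff_left)
  then show ?thesis
    by (simp add: cinner_self)
qed

lemma scaleC_diff_right: "c *\<^sub>C (x - y) = c *\<^sub>C x - c *\<^sub>C (y :: 'a :: complex_inner)"
  using scaleC_add_right [of c "x - y" y] by (simp add: algebra_simps)

lemma scaleC_one [simp]: "1 *\<^sub>C x = (x :: 'a :: complex_inner)"
  using scaleC_of_real [of 1 x] by simp

lemma complex_linear_compose:
  "complex_linear S \<Longrightarrow> complex_linear T \<Longrightarrow> complex_linear (S o\<^sub>L T)"
  by (simp add: complex_linear_def)

text \<open>Since \<open>op_adjoint\<close> is a definite description, a candidate also has to be
  unique; this follows because a vector is determined by its inner products with all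
  vectors.\<close>

lemma op_adjoint_eqI:
  assumes "complex_linear S"
    and "\<And>x y. cinner (blinfun_apply T x) y = cinner x (blinfun_apply S y)"
  shows "op_adjoint T = S"
  unfolding op_adjoint_def
proof (rule the_equality)
  show "complex_linear S \<and>
      (\<forall>x y. cinner (blinfun_apply T x) y = cinner x (blinfun_apply S y))"
    using assms by blast
  fix S'
  assume S': "complex_linear S' \<and>
      (\<forall>x y. cinner (blinfun_apply T x) y = cinner x (blinfun_apply S' y))"
  show "S' = S"
  proof (rule blinfun_eqI)
    show "blinfun_apply S' y = blinfun_apply S y" for y
      by (rule cinner_left_eqI) (use S' assms(2) in metis)
  qed
qed

text \<open>For \<open>w = P v - a v\<close> one has \<open>(P + a) w = P (P v) - a^2 v = 0\<close>.
  Pairing with \<open>w\<close> gives a sum of two nonnegative terms equal to 0, so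
  \<open>w = 0\<close>. This yields uniqueness of square roots of diagonal operators without
  spectral theory.\<close>

lemma positive_op_eigenvector:
  assumes P: "positive_op P" and sq: "blinfun_apply P (blinfun_apply P v) = (a * a) *\<^sub>R v"
    and "a > 0"
  shows "blinfun_apply P v = a *\<^sub>R v"
proof -
  let ?w = "blinfun_apply P v - a *\<^sub>R v"
  have "blinfun_apply P ?w + a *\<^sub>R ?w = 0"
    by (simp add: blinfun.diff_right blinfun.scaleR_right sq algebra_simps)
  then have "cinner (blinfun_apply P ?w + complex_of_real a *\<^sub>C ?w) ?w = 0"
    by (simp only: scaleC_of_real) (simp add: cinner_diff_left [of 0 0, simplified])
  then have "Re (cinner (blinfun_apply P ?w) ?w) + a * (norm ?w)\<^sup>2 = 0"
    by (simp add: cinner_add_left cinner_scaleC_left cinner_self complex_eq_iff)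
  moreover have "Re (cinner (blinfun_apply P ?w) ?w) \<ge> 0"
    using P by (auto simp: positive_op_def complex_nonneg_Reals_iff)
  moreover have "a * (norm ?w)\<^sup>2 \<ge> 0"
    using \<open>a > 0\<close> by simp
  ultimately have "a * (norm ?w)\<^sup>2 = 0"
    by linarith
  then show ?thesis
    using \<open>a > 0\<close> by simp
qed

text \<open>The solution of \<open>T x - c x = y\<close> is the fixed point of the contraction \<open>x \<mapsto> (T x - y) / c\<close>.\<close>

lemma op_invertible_diff_scalar_op:
  fixes T :: "'a :: complex_hilbert \<Rightarrow>\<^sub>L 'a"
  assumes T: "complex_linear T" and less: "norm T < cmod c"
  shows "op_invertible (T - scalar_op c)"
proof -
  have "c \<noteq> 0"
    using less by auto
  have cpos: "cmod c > 0"
    using \<open>c \<noteq> 0\<close> by simp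
  let ?A = "T - scalar_op c"
  have A: "blinfun_apply ?A x = blinfun_apply T x - c *\<^sub>C x" for x
    by (simp add: blinfun.diff_left scalar_op.rep_eq)
  have "\<exists>!x\<in>UNIV. inverse c *\<^sub>C (blinfun_apply T x - y) = x" for y
  proof (rule Banach_fix)
    show "0 \<le> norm T / cmod c" "norm T / cmod c < 1"
      using less cpos by (simp_all)
    show "dist (inverse c *\<^sub>C (blinfun_apply T x - y))
        (inverse c *\<^sub>C (blinfun_apply T z - y)) \<le> norm T / cmod c * dist x z" for x z
    proof -
      have "inverse c *\<^sub>C (blinfun_apply T x - y) - inverse c *\<^sub>C (blinfun_apply T z - y)
          = inverse c *\<^sub>C blinfun_apply T (x - z)"
        by (simp add: scaleC_diff_right blinfun.diff_right)
      then have "dist (inverse c *\<^sub>C (blinfun_apply T x - y))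
          (inverse c *\<^sub>C (blinfun_apply T z - y)) = norm (blinfun_apply T (x - z)) / cmod c"
        by (simp only: dist_norm norm_scaleC norm_inverse divide_inverse mult.commute)
      also have "\<dots> \<le> norm T * norm (x - z) / cmod c"
        by (intro divide_right_mono norm_blinfun) simp
      finally show ?thesis
        by (simp add: dist_norm)
    qed
  qed (auto simp: complete_UNIV)
  moreover have "inverse c *\<^sub>C (blinfun_apply T x - y) = x \<longleftrightarrow> blinfun_apply ?A x = y" for x y
  proof -
    have "inverse c *\<^sub>C (blinfun_apply T x - y) = x \<longleftrightarrow> blinfun_apply T x - y = c *\<^sub>C x"
    proof
      assume eq: "inverse c *\<^sub>C (blinfun_apply T x - y) = x"
      have "c *\<^sub>C (inverse c *\<^sub>C (blinfun_apply T x - y)) = blinfun_apply T x - y"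
        using \<open>c \<noteq> 0\<close> by (simp add: scaleC_scaleC)
      then show "blinfun_apply T x - y = c *\<^sub>C x"
        by (simp add: eq)
    next
      assume "blinfun_apply T x - y = c *\<^sub>C x"
      then show "inverse c *\<^sub>C (blinfun_apply T x - y) = x"
        using \<open>c \<noteq> 0\<close> by (simp add: scaleC_scaleC)
    qed
    then show ?thesis
      by (auto simp: A algebra_simps)
  qed
  ultimately have ex1: "\<exists>!x. blinfun_apply ?A x = y" for y
    by simp
  then obtain s where s: "\<And>y. blinfun_apply ?A (s y) = y"
    by metis
  \<comment> \<open>Unique solvability makes the solution map \<open>s\<close> inherit additivity
    and homogeneity from \<open>?A\<close>.\<close>
  have uniq: "s y = x" if "blinfun_apply ?A x = y" for x y
    using ex1 [of y] s [of y] that by auto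
  have clin: "blinfun_apply ?A (k *\<^sub>C x) = k *\<^sub>C blinfun_apply ?A x" for k x
    using T by (simp add: A complex_linear_def scaleC_diff_right scaleC_scaleC mult.commute)
  have "bounded_linear s"
  proof (rule bounded_linear_intro)
    show "s (x + y) = s x + s y" for x y
      by (rule uniq) (simp add: blinfun.add_right s)
    show "s (r *\<^sub>R x) = r *\<^sub>R s x" for r x
      by (rule uniq) (simp add: blinfun.scaleR_right s)
    fix y
    \<comment> \<open>From \<open>c s(y) = T s(y) - y\<close> follows
      \<open>(cmod c - norm T) * norm (s y) \<le> norm y\<close>, which bounds the inverse.\<close>
    have "cmod c * norm (s y) = norm (blinfun_apply T (s y) - y)"
      using s [of y] by (simp add: A norm_scaleC [symmetric] algebra_simps)
    also have "\<dots> \<le> norm T * norm (s y) + norm y"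
      using norm_triangle_ineq4 [of "blinfun_apply T (s y)" y] norm_blinfun [of T "s y"] by linarith
    finally show "norm (s y) \<le> norm y * (1 / (cmod c - norm T))"
      using less by (simp add: field_simps)
  qed
  then have ap: "blinfun_apply (Blinfun s) = s"
    by (rule bounded_linear_Blinfun_apply)
  show ?thesis
    unfolding op_invertible_def
  proof (intro exI conjI)
    show "complex_linear (Blinfun s)"
      unfolding complex_linear_def ap using uniq clin s by metis
    show "Blinfun s o\<^sub>L ?A = id_blinfun"
      by (rule blinfun_eqI) (simp add: ap uniq)
    show "?A o\<^sub>L Blinfun s = id_blinfun"
      by (rule blinfun_eqI) (simp add: ap s)
  qed
qed

lemma op_invertible_similar:
  assumes "op_invertible A" "complex_linear D" "complex_linear E"
    and "D o\<^sub>L E = id_blinfun" "E o\<^sub>L D = id_blinfun"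
  shows "op_invertible (D o\<^sub>L A o\<^sub>L E)"
proof -
  obtain S where S: "complex_linear S" "S o\<^sub>L A = id_blinfun" "A o\<^sub>L S = id_blinfun"
    using assms(1) by (auto simp: op_invertible_def)
  have pt: "\<And>x. blinfun_apply D (blinfun_apply E x) = x" "\<And>x. blinfun_apply E (blinfun_apply D x) = x"
    "\<And>x. blinfun_apply S (blinfun_apply A x) = x" "\<And>x. blinfun_apply A (blinfun_apply S x) = x"
    using assms(4,5) S by (metis blinfun_apply_blinfun_compose blinfun_apply_id_blinfun)+
  show ?thesis
    unfolding op_invertible_def
  proof (intro exI conjI)
    show "complex_linear (D o\<^sub>L S o\<^sub>L E)"
      using assms S by (simp add: complex_linear_compose)
  qed (auto intro!: blinfun_eqI simp: pt)
qed


section \<open>Operators on square-summable sequences\<close>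

lemma ell2_eqI: "(\<And>i. ell2_nth x i = ell2_nth y i) \<Longrightarrow> x = y"
  by (simp add: ell2_nth_inject [symmetric] fun_eq_iff)

section \<open>Unit vectors and operators given by coordinate formulas\<close>

lift_definition ell2_unit :: "nat \<Rightarrow> ell2" is "\<lambda>k i. if i = k then 1 else 0"
  by (rule summable_finite [of "{k}" for k]) auto

lemma norm_ell2_unit [simp]: "norm (ell2_unit k) = 1"
proof -
  have "(norm (ell2_unit k))\<^sup>2 = (\<Sum>i\<in>{k}. (cmod (ell2_nth (ell2_unit k) i))\<^sup>2)"
    unfolding norm_ell2_square by (rule suminf_finite) (auto simp: ell2_unit.rep_eq)
  then show ?thesis
    by (simp add: ell2_unit.rep_eq power2_eq_1_iff) (smt (verit) norm_ge_zero)
qed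

lemma ell2_nth_sum: "ell2_nth (\<Sum>k\<in>A. f k) i = (\<Sum>k\<in>A. ell2_nth (f k) i)"
  by (induction A rule: infinite_finite_induct) (simp_all add: zero_ell2.rep_eq plus_ell2.rep_eq)

lemma ell2_unit_expansion: "(\<lambda>k. ell2_nth x k *\<^sub>C ell2_unit k) sums x"
  unfolding sums_def
proof (rule Lim_null [THEN iffD2], rule tendsto_norm_zero_cancel)
  let ?r = "\<lambda>n. (\<Sum>k<n. ell2_nth x k *\<^sub>C ell2_unit k) - x"
  let ?f = "\<lambda>i. (cmod (ell2_nth x i))\<^sup>2"
  have nth: "ell2_nth (?r n) i = (if i < n then 0 else - ell2_nth x i)" for n i
    by (simp add: minus_ell2.rep_eq ell2_nth_sum scaleC_ell2.rep_eq ell2_unit.rep_eq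
        if_distrib [where f = "\<lambda>z. w * z" for w] cong: if_cong)
  \<comment> \<open>The squared norm of the remainder is the tail of the convergent series for the
    squared norm of \<open>x\<close>.\<close>
  have "(norm (?r n))\<^sup>2 = suminf ?f - (\<Sum>i<n. ?f i)" for n
  proof -
    have "(norm (?r n))\<^sup>2
        = (\<Sum>i. (cmod (ell2_nth (?r n) (i + n)))\<^sup>2) + (\<Sum>i<n. (cmod (ell2_nth (?r n) i))\<^sup>2)"
      unfolding norm_ell2_square by (rule suminf_split_initial_segment) (rule summable_ell2)
    also have "\<dots> = (\<Sum>i. ?f (i + n))"
      by (simp add: nth)
    also have "\<dots> = suminf ?f - (\<Sum>i<n. ?f i)"
      by (rule suminf_minus_initial_segment) (rule summable_ell2)
    finally show ?thesis .
  qed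
  moreover have "(\<lambda>n. suminf ?f - (\<Sum>i<n. ?f i)) \<longlonglongrightarrow> suminf ?f - suminf ?f"
    by (intro tendsto_intros summable_LIMSEQ summable_ell2)
  ultimately have "(\<lambda>n. (norm (?r n))\<^sup>2) \<longlonglongrightarrow> 0"
    by simp
  from tendsto_real_sqrt [OF this] show "(\<lambda>n. norm (?r n)) \<longlonglongrightarrow> 0"
    by simp
qed

text \<open>Both operators are continuous and complex-linear, so they may be applied termwise to the
  unit vector expansion. The uniqueness of square root and polar factor is reduced to unit vectors
  in this way.\<close>

lemma ell2_op_eqI:
  fixes S T :: "ell2 \<Rightarrow>\<^sub>L ell2"
  assumes "complex_linear S" "complex_linear T"
    and "\<And>k. blinfun_apply S (ell2_unit k) = blinfun_apply T (ell2_unit k)"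
  shows "S = T"
proof (rule blinfun_eqI)
  fix x
  have "(\<lambda>k. blinfun_apply S (ell2_nth x k *\<^sub>C ell2_unit k)) sums blinfun_apply S x"
    "(\<lambda>k. blinfun_apply T (ell2_nth x k *\<^sub>C ell2_unit k)) sums blinfun_apply T x"
    by (intro bounded_linear.sums [OF blinfun.bounded_linear_right ell2_unit_expansion])+
  then show "blinfun_apply S x = blinfun_apply T x"
    using assms by (simp add: complex_linear_def sums_unique2)
qed

definition seq_op :: "((nat \<Rightarrow> complex) \<Rightarrow> nat \<Rightarrow> complex) \<Rightarrow> (ell2 \<Rightarrow>\<^sub>L ell2)"
  where "seq_op F = Blinfun (\<lambda>x. Abs_ell2 (F (ell2_nth x)))"

text \<open>The bound is imposed on partial sums because summability of the image is not yet known: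
  it yields square-summability first and the norm estimate afterwards.\<close>

lemma
  assumes add: "\<And>x y. F (\<lambda>i. x i + y i) = (\<lambda>i. F x i + F y i)"
    and scale: "\<And>c x. F (\<lambda>i. c * x i) = (\<lambda>i. c * F x i)"
    and bound: "\<And>x n. (\<Sum>i<n. (cmod (F (ell2_nth x) i))\<^sup>2) \<le> (B * norm x)\<^sup>2"
    and "B \<ge> 0"
  shows seq_op_nth: "ell2_nth (blinfun_apply (seq_op F) x) = F (ell2_nth x)"
    and complex_linear_seq_op: "complex_linear (seq_op F)"
    and norm_seq_op_le: "norm (seq_op F) \<le> B"
proof -
  let ?f = "\<lambda>x. Abs_ell2 (F (ell2_nth x))"
  have summ: "summable (\<lambda>i. (cmod (F (ell2_nth x) i))\<^sup>2)" for x
    by (rule bounded_imp_summable [where B = "(B * norm x)\<^sup>2"])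
      (use bound [of x "Suc n" for n] in \<open>auto simp: lessThan_Suc_atMost\<close>)
  then have nth: "ell2_nth (?f x) = F (ell2_nth x)" for x
    by (simp add: Abs_ell2_inverse)
  have le: "norm (?f x) \<le> B * norm x" for x
  proof (rule power2_le_imp_le)
    show "(norm (?f x))\<^sup>2 \<le> (B * norm x)\<^sup>2"
      unfolding norm_ell2_square [of "?f x"] nth by (intro suminf_le_const summ bound)
  qed (simp add: \<open>B \<ge> 0\<close>)
  have clin: "?f (c *\<^sub>C x) = c *\<^sub>C ?f x" for c x
    unfolding ell2_nth_inject [symmetric] nth unfolding scaleC_ell2.rep_eq nth by (rule scale)
  have "bounded_linear ?f"
  proof (rule bounded_linear_intro [where K = B])
    show "?f (x + y) = ?f x + ?f y" for x y
      unfolding ell2_nth_inject [symmetric] nth unfolding plus_ell2.rep_eq nth by (rule add)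
    show "?f (r *\<^sub>R x) = r *\<^sub>R ?f x" for r x
      using clin [of "complex_of_real r" x] by (simp only: scaleC_of_real)
    show "norm (?f x) \<le> norm x * B" for x
      using le [of x] by (simp add: mult.commute)
  qed
  then have ap: "blinfun_apply (seq_op F) = ?f"
    unfolding seq_op_def by (rule bounded_linear_Blinfun_apply)
  show "ell2_nth (blinfun_apply (seq_op F) x) = F (ell2_nth x)"
    by (simp only: ap nth)
  show "complex_linear (seq_op F)"
    by (simp only: complex_linear_def ap clin simp_thms)
  show "norm (seq_op F) \<le> B"
    by (rule norm_blinfun_bound) (simp_all only: ap le \<open>B \<ge> 0\<close>)
qed

section \<open>Diagonal operators and their square roots\<close>

definition diag_op :: "(nat \<Rightarrow> real) \<Rightarrow> (ell2 \<Rightarrow>\<^sub>L ell2)"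
  where "diag_op a = seq_op (\<lambda>x i. complex_of_real (a i) * x i)"

lemma
  assumes a: "\<And>i. \<bar>a i\<bar> \<le> B"
  shows diag_op_nth':
      "ell2_nth (blinfun_apply (diag_op a) x) i = complex_of_real (a i) * ell2_nth x i"
    and complex_linear_diag_op': "complex_linear (diag_op a)"
    and norm_diag_op_le: "norm (diag_op a) \<le> B"
proof -
  let ?F = "\<lambda>x i. complex_of_real (a i) * x i"
  have bound: "(\<Sum>i<n. (cmod (?F (ell2_nth x) i))\<^sup>2) \<le> (B * norm x)\<^sup>2" for x n
  proof -
    have "(\<Sum>i<n. (cmod (?F (ell2_nth x) i))\<^sup>2) \<le> (\<Sum>i<n. B\<^sup>2 * (cmod (ell2_nth x i))\<^sup>2)"
      unfolding norm_mult norm_of_real power_mult_distrib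
      by (intro sum_mono mult_right_mono power_mono a) auto
    also have "\<dots> \<le> B\<^sup>2 * (norm x)\<^sup>2"
      unfolding sum_distrib_left [symmetric] by (intro mult_left_mono sum_le_norm_ell2) simp
    finally show ?thesis
      by (simp only: power_mult_distrib)
  qed
  have "B \<ge> 0"
    using a [of 0] by linarith
  have add: "?F (\<lambda>i. x i + y i) = (\<lambda>i. ?F x i + ?F y i)"
    and scale: "?F (\<lambda>i. c * x i) = (\<lambda>i. c * ?F x i)" for x y c
    by (simp_all add: algebra_simps)
  note op = seq_op_nth [of ?F B, OF add scale bound \<open>B \<ge> 0\<close>]
    complex_linear_seq_op [of ?F B, OF add scale bound \<open>B \<ge> 0\<close>]
    norm_seq_op_le [of ?F B, OF add scale bound \<open>B \<ge> 0\<close>]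
  show "ell2_nth (blinfun_apply (diag_op a) x) i = complex_of_real (a i) * ell2_nth x i"
    unfolding diag_op_def by (simp only: op)
  show "complex_linear (diag_op a)"
    unfolding diag_op_def by (rule op)
  show "norm (diag_op a) \<le> B"
    unfolding diag_op_def by (rule op)
qed

lemma
  assumes "bounded (range a)"
  shows diag_op_nth:
      "ell2_nth (blinfun_apply (diag_op a) x) i = complex_of_real (a i) * ell2_nth x i"
    and complex_linear_diag_op: "complex_linear (diag_op a)"
proof -
  obtain B where "\<And>i. \<bar>a i\<bar> \<le> B"
    using assms by (auto simp: bounded_iff)
  then show "ell2_nth (blinfun_apply (diag_op a) x) i = complex_of_real (a i) * ell2_nth x i"
    "complex_linear (diag_op a)"
    by (rule diag_op_nth' complex_linear_diag_op')+
qed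

lemma diag_op_unit:
  assumes "bounded (range a)"
  shows "blinfun_apply (diag_op a) (ell2_unit k) = a k *\<^sub>R ell2_unit k"
  by (rule ell2_eqI) (simp add: diag_op_nth assms scaleR_ell2.rep_eq ell2_unit.rep_eq)

lemma positive_diag_op:
  assumes "bounded (range a)" and pos: "\<And>i. a i \<ge> 0"
  shows "positive_op (diag_op a)"
  unfolding positive_op_def
proof (intro conjI allI)
  show "complex_linear (diag_op a)"
    by (rule complex_linear_diag_op [OF assms(1)])
  fix x
  let ?y = "blinfun_apply (diag_op a) x"
  have eq: "ell2_nth ?y i * cnj (ell2_nth x i) = complex_of_real (a i * (cmod (ell2_nth x i))\<^sup>2)"
    for i
    by (simp add: diag_op_nth assms complex_norm_square [symmetric] mult.assoc)
  have summ: "summable (\<lambda>i. complex_of_real (a i * (cmod (ell2_nth x i))\<^sup>2))"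
    using square_summable_prod [OF summable_ell2 summable_ell2, of ?y x] unfolding eq .
  have "cinner ?y x = complex_of_real (\<Sum>i. a i * (cmod (ell2_nth x i))\<^sup>2)"
    unfolding cinner_ell2.rep_eq eq by (rule suminf_of_real [symmetric]) (use summ in \<open>simp only: summable_of_real_iff\<close>)
  moreover have "(\<Sum>i. a i * (cmod (ell2_nth x i))\<^sup>2) \<ge> 0"
    by (rule suminf_nonneg) (use summ pos in \<open>simp_all only: summable_of_real_iff, simp\<close>)
  ultimately show "cinner ?y x \<in> \<real>\<^sub>\<ge>\<^sub>0"
    by simp
qed

lemma bounded_range_mult:
  fixes a b :: "nat \<Rightarrow> real"
  assumes "bounded (range a)" "bounded (range b)"
  shows "bounded (range (\<lambda>i. a i * b i))"
proof -
  obtain A B where "\<And>i. \<bar>a i\<bar> \<le> A" "\<And>i. \<bar>b i\<bar> \<le> B"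
    using assms by (auto simp: bounded_iff)
  then have "\<bar>a i * b i\<bar> \<le> A * B" for i
    unfolding abs_mult by (meson abs_ge_zero mult_mono order_trans)
  then show ?thesis
    by (auto simp: bounded_iff)
qed

text \<open>For uniqueness, a positive root \<open>P\<close> satisfies
  \<open>P (P e) = (a k)^2 e\<close> for the unit vector \<open>e\<close> of index \<open>k\<close>.
  As \<open>a k > 0\<close>, the eigenvector lemma forces \<open>P e = a k e\<close>.\<close>

lemma op_sqrt_diag_op:
  assumes bdd: "bounded (range a)" and pos: "\<And>i. a i > 0"
  shows "op_sqrt (diag_op (\<lambda>i. a i * a i)) = diag_op a"
  unfolding op_sqrt_def
proof (rule the_equality)
  note bdd2 = bounded_range_mult [OF bdd bdd]
  show "positive_op (diag_op a) \<and> diag_op a o\<^sub>L diag_op a = diag_op (\<lambda>i. a i * a i)"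
    using pos by (auto intro!: positive_diag_op bdd blinfun_eqI ell2_eqI
        simp: diag_op_nth bdd bdd2 less_imp_le)
  fix P
  assume P: "positive_op P \<and> P o\<^sub>L P = diag_op (\<lambda>i. a i * a i)"
  show "P = diag_op a"
  proof (rule ell2_op_eqI)
    show "complex_linear P"
      using P by (simp add: positive_op_def)
    show "complex_linear (diag_op a)"
      by (rule complex_linear_diag_op [OF bdd])
    fix k
    have "blinfun_apply (P o\<^sub>L P) (ell2_unit k) = (a k * a k) *\<^sub>R ell2_unit k"
      using P by (simp only: diag_op_unit [OF bdd2])
    then have "blinfun_apply P (blinfun_apply P (ell2_unit k)) = (a k * a k) *\<^sub>R ell2_unit k"
      by simp
    then show "blinfun_apply P (ell2_unit k) = blinfun_apply (diag_op a) (ell2_unit k)"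
      unfolding diag_op_unit [OF bdd] using P pos [of k] by (intro positive_op_eigenvector) auto
  qed
qed

text \<open>This is the adjoint of the unweighted shift.\<close>

definition backward_shift :: "ell2 \<Rightarrow>\<^sub>L ell2"
  where "backward_shift = seq_op (\<lambda>x i. x (Suc i))"

lemma backward_shift_nth: "ell2_nth (blinfun_apply backward_shift x) i = ell2_nth x (Suc i)"
  and complex_linear_backward_shift: "complex_linear backward_shift"
proof -
  have bound: "(\<Sum>i<n. (cmod (ell2_nth x (Suc i)))\<^sup>2) \<le> (1 * norm x)\<^sup>2" for x n
  proof -
    have "(\<Sum>i<n. (cmod (ell2_nth x (Suc i)))\<^sup>2) \<le> (\<Sum>i<Suc n. (cmod (ell2_nth x i))\<^sup>2)"
      unfolding sum.lessThan_Suc_shift by simp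
    also have "\<dots> \<le> (norm x)\<^sup>2"
      by (rule sum_le_norm_ell2)
    finally show ?thesis
      by simp
  qed
  note op = seq_op_nth [of "\<lambda>x i. x (Suc i)" 1] complex_linear_seq_op [of "\<lambda>x i. x (Suc i)" 1]
  show "ell2_nth (blinfun_apply backward_shift x) i = ell2_nth x (Suc i)"
    unfolding backward_shift_def by (subst op) (auto simp only: bound zero_le_one)
  show "complex_linear backward_shift"
    unfolding backward_shift_def by (rule op) (auto simp only: bound zero_le_one)
qed


section \<open>The mean transform of a weighted shift\<close>

lemma
  assumes "bounded (range a)"
  shows weighted_shift_nth_0 [simp]: "ell2_nth (blinfun_apply (weighted_shift a) x) 0 = 0"
    and weighted_shift_nth_Suc [simp]: "ell2_nth (blinfun_apply (weighted_shift a) x) (Suc i)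
      = complex_of_real (a i) * ell2_nth x i"
  by (simp_all add: weighted_shift_nth [OF assms] shift_seq_def)

text \<open>The coordinates of the shifted vector are those of the diagonal image moved one place
  behind a leading zero, so norm estimates for shifts reduce to diagonal operators.\<close>

lemma norm_weighted_shift_apply:
  assumes bdd: "bounded (range a)"
  shows "norm (blinfun_apply (weighted_shift a) x) = norm (blinfun_apply (diag_op a) x)"
proof -
  let ?y = "blinfun_apply (weighted_shift a) x"
  have "(norm ?y)\<^sup>2 = (\<Sum>i. (cmod (ell2_nth ?y (Suc i)))\<^sup>2)"
    unfolding norm_ell2_square by (subst suminf_split_head [OF summable_ell2]) (simp add: bdd)
  also have "\<dots> = (norm (blinfun_apply (diag_op a) x))\<^sup>2"
    by (simp add: norm_ell2_square bdd diag_op_nth)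
  finally show ?thesis
    by (simp add: power2_eq_iff_nonneg)
qed

lemma norm_weighted_shift_le:
  assumes "\<And>i. \<bar>a i\<bar> \<le> B"
  shows "norm (weighted_shift a) \<le> B"
proof (rule norm_blinfun_bound)
  show "B \<ge> 0"
    using assms [of 0] by linarith
  have bdd: "bounded (range a)"
    using assms by (auto simp: bounded_iff)
  fix x
  have "norm (blinfun_apply (diag_op a) x) \<le> norm (diag_op a) * norm x"
    by (rule norm_blinfun)
  also have "\<dots> \<le> B * norm x"
    by (intro mult_right_mono norm_diag_op_le assms) simp
  finally show "norm (blinfun_apply (weighted_shift a) x) \<le> B * norm x"
    by (simp only: norm_weighted_shift_apply [OF bdd])
qed

text \<open>The unit vector of index \<open>i\<close> is mapped to a vector whose coordinate
  \<open>Suc i\<close> is \<open>a i\<close>.\<close>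

lemma weight_le_norm_weighted_shift:
  assumes bdd: "bounded (range a)"
  shows "a i \<le> norm (weighted_shift a)"
proof -
  have "a i \<le> cmod (ell2_nth (blinfun_apply (weighted_shift a) (ell2_unit i)) (Suc i))"
    by (simp add: bdd ell2_unit.rep_eq)
  also have "\<dots> \<le> norm (blinfun_apply (weighted_shift a) (ell2_unit i))"
    by (rule cmod_ell2_nth_le)
  also have "\<dots> \<le> norm (weighted_shift a)"
    using norm_blinfun [of "weighted_shift a" "ell2_unit i"] by simp
  finally show ?thesis .
qed

section \<open>Adjoint, modulus and polar factor of a weighted shift\<close>

lemma op_adjoint_weighted_shift:
  assumes bdd: "bounded (range a)"
  shows "op_adjoint (weighted_shift a) = diag_op a o\<^sub>L backward_shift"
proof (rule op_adjoint_eqI)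
  show "complex_linear (diag_op a o\<^sub>L backward_shift)"
    by (intro complex_linear_compose complex_linear_diag_op complex_linear_backward_shift bdd)
  fix x y
  let ?Wx = "blinfun_apply (weighted_shift a) x"
  \<comment> \<open>The term of index 0 vanishes, so the series can be reindexed from
    \<open>Suc i\<close>; this is where the backward shift comes from.\<close>
  have "cinner ?Wx y = (\<Sum>i. ell2_nth ?Wx (Suc i) * cnj (ell2_nth y (Suc i)))"
    unfolding cinner_ell2.rep_eq
    by (subst suminf_split_head [OF square_summable_prod [OF summable_ell2 summable_ell2]])
      (simp add: bdd)
  then show "cinner ?Wx y = cinner x (blinfun_apply (diag_op a o\<^sub>L backward_shift) y)"
    by (simp add: cinner_ell2.rep_eq bdd diag_op_nth backward_shift_nth mult_ac)
qed

lemma op_abs_weighted_shift: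
  assumes bdd: "bounded (range a)" and pos: "\<And>i. a i > 0"
  shows "op_abs (weighted_shift a) = diag_op a"
proof -
  have "op_adjoint (weighted_shift a) o\<^sub>L weighted_shift a = diag_op (\<lambda>i. a i * a i)"
    by (intro blinfun_eqI ell2_eqI)
      (simp add: op_adjoint_weighted_shift diag_op_nth backward_shift_nth bdd bounded_range_mult)
  then show ?thesis
    by (simp add: op_abs_def op_sqrt_diag_op bdd pos)
qed

lemma null_space_weighted_shift:
  assumes bdd: "bounded (range a)" and pos: "\<And>i. a i > 0"
  shows "null_space (weighted_shift a) = {0}"
proof (intro equalityI subsetI)
  fix x
  assume "x \<in> null_space (weighted_shift a)"
  then have "ell2_nth (blinfun_apply (weighted_shift a) x) (Suc i) = 0" for i
    by (simp add: null_space_def zero_ell2.rep_eq)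
  then have "complex_of_real (a i) * ell2_nth x i = 0" for i
    by (simp only: weighted_shift_nth_Suc [OF bdd])
  then have "ell2_nth x i = 0" for i
    using pos [of i] by (metis mult_eq_0_iff of_real_eq_0_iff less_irrefl)
  then show "x \<in> {0}"
    by (auto intro!: ell2_eqI simp: zero_ell2.rep_eq)
qed (simp add: null_space_def)

abbreviation unilateral_shift :: "ell2 \<Rightarrow>\<^sub>L ell2"
  where "unilateral_shift \<equiv> weighted_shift (\<lambda>_. 1)"

lemma norm_unilateral_shift_apply: "norm (blinfun_apply unilateral_shift x) = norm x"
proof -
  have "blinfun_apply (diag_op (\<lambda>_. 1)) x = x"
    by (rule ell2_eqI) (simp add: diag_op_nth)
  then show ?thesis
    by (simp add: norm_weighted_shift_apply)
qed

text \<open>The unweighted shift is isometric, hence a partial isometry with trivial null space, as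
  required. Any other factor agrees with it on each unit vector, since the factorization there can
  be divided by \<open>a k > 0\<close>.\<close>

lemma polar_factor_weighted_shift:
  assumes bdd: "bounded (range a)" and pos: "\<And>i. a i > 0"
  shows "polar_factor (weighted_shift a) = unilateral_shift"
  unfolding polar_factor_def op_abs_weighted_shift [OF assms]
proof (rule the_equality)
  have factor: "weighted_shift a = unilateral_shift o\<^sub>L diag_op a"
  proof (intro blinfun_eqI ell2_eqI)
    show "ell2_nth (blinfun_apply (weighted_shift a) x) i
        = ell2_nth (blinfun_apply (unilateral_shift o\<^sub>L diag_op a) x) i" for x i
      by (cases i) (simp_all add: bdd diag_op_nth)
  qed
  show "partial_isometry unilateral_shift \<and> null_space unilateral_shift = null_space (weighted_shift a)
      \<and> weighted_shift a = unilateral_shift o\<^sub>L diag_op a"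
    by (intro conjI factor) (simp_all add: partial_isometry_def complex_linear_weighted_shift
        norm_unilateral_shift_apply null_space_weighted_shift assms)
  fix V
  assume V: "partial_isometry V \<and> null_space V = null_space (weighted_shift a)
      \<and> weighted_shift a = V o\<^sub>L diag_op a"
  show "V = unilateral_shift"
  proof (rule ell2_op_eqI)
    show "complex_linear V"
      using V by (simp add: partial_isometry_def)
    show "complex_linear unilateral_shift"
      by (simp add: complex_linear_weighted_shift)
    fix k
    have "blinfun_apply (V o\<^sub>L diag_op a) (ell2_unit k)
        = blinfun_apply (unilateral_shift o\<^sub>L diag_op a) (ell2_unit k)"
      using V factor by simp
    then have "a k *\<^sub>R blinfun_apply V (ell2_unit k)
        = a k *\<^sub>R blinfun_apply unilateral_shift (ell2_unit k)"
      by (simp add: diag_op_unit bdd blinfun.scaleR_right)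
    then show "blinfun_apply V (ell2_unit k) = blinfun_apply unilateral_shift (ell2_unit k)"
      using pos [of k] by simp
  qed
qed

section \<open>Averaging of weights and the mean limit\<close>

definition weight_mean :: "(nat \<Rightarrow> real) \<Rightarrow> nat \<Rightarrow> real"
  where "weight_mean a i = (a i + a (Suc i)) / 2"

lemma bounded_range_weight_mean:
  assumes "bounded (range a)"
  shows "bounded (range (weight_mean a))"
proof -
  obtain B where B: "\<And>i. \<bar>a i\<bar> \<le> B"
    using assms by (auto simp: bounded_iff)
  have "\<bar>weight_mean a i\<bar> \<le> B" for i
    using B [of i] B [of "Suc i"] by (simp add: weight_mean_def)
  then show ?thesis
    by (auto simp: bounded_iff)
qed

text \<open>In coordinate \<open>Suc i\<close>, shifting after scaling contributes the weight
  \<open>a i\<close>, whereas scaling after shifting contributes \<open>a (Suc i)\<close>.\<close>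

lemma mean_transform_weighted_shift:
  assumes bdd: "bounded (range a)" and pos: "\<And>i. a i > 0"
  shows "mean_transform (weighted_shift a) = weighted_shift (weight_mean a)"
proof (intro blinfun_eqI ell2_eqI)
  fix x i
  note nth = weighted_shift_nth_0 [OF bounded_range_weight_mean [OF bdd]]
    weighted_shift_nth_Suc [OF bounded_range_weight_mean [OF bdd]]
  show "ell2_nth (blinfun_apply (mean_transform (weighted_shift a)) x) i
      = ell2_nth (blinfun_apply (weighted_shift (weight_mean a)) x) i"
    by (cases i) (simp_all add: mean_transform_def op_abs_weighted_shift polar_factor_weighted_shift
        assms blinfun.add_left blinfun.scaleR_left scaleR_ell2.rep_eq plus_ell2.rep_eq
        nth diag_op_nth weight_mean_def [of a] algebra_simps add_divide_distrib)
qed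

lemma mean_transform_iterate_weighted_shift:
  assumes bdd: "bounded (range a)" and pos: "\<And>i. a i > 0"
  shows "bounded (range ((weight_mean ^^ n) a))" "(weight_mean ^^ n) a i > 0"
    "(mean_transform ^^ n) (weighted_shift a) = weighted_shift ((weight_mean ^^ n) a)"
proof -
  \<comment> \<open>The three claims go through one induction because the formula for the mean
    transform needs bounded, positive weights at every stage.\<close>
  have "bounded (range ((weight_mean ^^ n) a)) \<and> (\<forall>i. (weight_mean ^^ n) a i > 0) \<and>
      (mean_transform ^^ n) (weighted_shift a) = weighted_shift ((weight_mean ^^ n) a)"
  proof (induction n)
    case 0
    then show ?case
      using assms by simp
  next
    case (Suc n)
    then have "weight_mean ((weight_mean ^^ n) a) i > 0" for i
      unfolding weight_mean_def [of "(weight_mean ^^ n) a" i] by (simp add: add_pos_pos)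
    then show ?case
      using Suc by (simp add: mean_transform_weighted_shift bounded_range_weight_mean)
  qed
  then show "bounded (range ((weight_mean ^^ n) a))" "(weight_mean ^^ n) a i > 0"
    "(mean_transform ^^ n) (weighted_shift a) = weighted_shift ((weight_mean ^^ n) a)"
    by auto
qed

lemma weight_mean_iterate_tendsto:
  assumes "a \<longlonglongrightarrow> L"
  shows "(weight_mean ^^ n) a \<longlonglongrightarrow> L"
proof (induction n)
  case 0
  then show ?case
    using assms by simp
next
  case (Suc n)
  have "(\<lambda>i. ((weight_mean ^^ n) a i + (weight_mean ^^ n) a (Suc i)) / 2) \<longlonglongrightarrow> (L + L) / 2"
    using Suc by (intro tendsto_intros LIMSEQ_Suc) auto
  then show ?case
    unfolding weight_mean_def [of "(weight_mean ^^ n) a", symmetric] by simp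
qed

text \<open>Averaging is monotone, fixes the constant \<open>M\<close>, and has
  \<open>(1/2)^i\<close> as an eigenvector with eigenvalue \<open>3/4\<close>.\<close>

lemma weight_mean_iterate_le:
  assumes "\<And>i. a i \<le> M + C * (1 / 2) ^ i"
  shows "(weight_mean ^^ n) a i \<le> M + C * (3 / 4) ^ n * (1 / 2) ^ i"
proof (induction n arbitrary: i)
  case 0
  then show ?case
    using assms by simp
next
  case (Suc n)
  show ?case
    using Suc [of i] Suc [of "Suc i"] by (simp add: weight_mean_def algebra_simps)
qed

lemma mean_limit_weighted_shift:
  assumes pos: "\<And>i. a i > 0" and lim: "a \<longlonglongrightarrow> L"
  shows "mean_limit (weighted_shift a) = L"
  unfolding mean_limit_def
proof (rule limI, rule LIMSEQ_I)
  fix e :: real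
  assume "e > 0"
  have bdd: "bounded (range a)"
    using lim by (simp add: convergentI convergent_imp_bounded)
  note iterate = mean_transform_iterate_weighted_shift [OF bdd pos]
  obtain B where B: "\<And>i. \<bar>a i\<bar> \<le> B"
    using bdd by (auto simp: bounded_iff)
  have "L \<ge> 0"
    using LIMSEQ_le_const [OF lim] pos less_imp_le by blast
  obtain N where N: "\<And>i. i \<ge> N \<Longrightarrow> \<bar>a i - L\<bar> < e / 2"
    using LIMSEQ_D [OF lim, of "e / 2"] \<open>e > 0\<close> by auto
  \<comment> \<open>With this choice \<open>C * (1/2)^i \<ge> B \<ge> a i\<close> for every
    \<open>i < N\<close>; from \<open>N\<close> on, the bound \<open>L + e / 2\<close> suffices
    alone.\<close>
  define C where "C = B * 2 ^ N"
  have "B \<ge> 0"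
    using B [of 0] by linarith
  then have "C \<ge> 0"
    by (simp add: C_def)
  have "a i \<le> (L + e / 2) + C * (1 / 2) ^ i" for i
  proof (cases "i \<ge> N")
    case True
    have "C * (1 / 2) ^ i \<ge> 0"
      using \<open>C \<ge> 0\<close> by simp
    then show ?thesis
      using N [OF True] by linarith
  next
    case False
    have "(2 :: real) ^ i \<le> 2 ^ N"
      using False by (intro power_increasing) auto
    then have "B * 1 \<le> B * (2 ^ N * (1 / 2) ^ i)"
      using \<open>B \<ge> 0\<close> by (intro mult_left_mono) (simp_all add: power_divide)
    then show ?thesis
      using B [of i] \<open>L \<ge> 0\<close> \<open>e > 0\<close> by (simp add: C_def mult.assoc)
  qed
  note upper = weight_mean_iterate_le [OF this]
  have "(\<lambda>n. C * (3 / 4) ^ n) \<longlonglongrightarrow> C * 0"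
    by (intro tendsto_intros LIMSEQ_realpow_zero) auto
  then obtain n0 where n0: "\<And>n. n \<ge> n0 \<Longrightarrow> C * (3 / 4) ^ n < e / 2"
    using LIMSEQ_D [of "\<lambda>n. C * (3 / 4) ^ n" 0 "e / 2"] \<open>e > 0\<close> by fastforce
  have "norm (norm ((mean_transform ^^ n) (weighted_shift a)) - L) < e" if "n \<ge> n0" for n
  proof -
    have "norm (weighted_shift ((weight_mean ^^ n) a)) \<le> L + e / 2 + C * (3 / 4) ^ n"
    proof (rule norm_weighted_shift_le)
      fix i
      have "C * (3 / 4) ^ n * (1 / 2) ^ i \<le> C * (3 / 4) ^ n * 1"
        using \<open>C \<ge> 0\<close> by (intro mult_left_mono power_le_one) auto
      then show "\<bar>(weight_mean ^^ n) a i\<bar> \<le> L + e / 2 + C * (3 / 4) ^ n"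
        using iterate(2) [of n i] upper [of n i] by simp
    qed
    \<comment> \<open>The weights of every iterate still tend to \<open>L\<close>, and none of them
      exceeds the norm.\<close>
    moreover have "L \<le> norm (weighted_shift ((weight_mean ^^ n) a))"
      by (rule LIMSEQ_le_const2 [OF weight_mean_iterate_tendsto [OF lim, of n]])
        (use weight_le_norm_weighted_shift [OF iterate(1)] in blast)
    ultimately show ?thesis
      using n0 [OF that] by (simp add: iterate(3))
  qed
  then show "\<exists>n0. \<forall>n\<ge>n0. norm (norm ((mean_transform ^^ n) (weighted_shift a)) - L) < e"
    by blast
qed


section \<open>The spectrum of a weighted shift\<close>

text \<open>A preimage \<open>x\<close> of the first unit vector would satisfy
  \<open>a i * x i = c * x (Suc i)\<close> with \<open>x 0\<close> nonzero; once
  \<open>a i > cmod c\<close> its entries no longer shrink, against square-summability. Allowing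
  \<open>c = 0\<close> provides a spectral value even if \<open>L = 0\<close>.\<close>

lemma op_spectrum_weighted_shift_ge:
  assumes pos: "\<And>i. a i > 0" and lim: "a \<longlonglongrightarrow> L" and c: "cmod c < L \<or> c = 0"
  shows "c \<in> op_spectrum (weighted_shift a)"
proof -
  have bdd: "bounded (range a)"
    using lim by (simp add: convergentI convergent_imp_bounded)
  have False if S: "(weighted_shift a - scalar_op c) o\<^sub>L S = id_blinfun" for S
  proof -
    define x where "x = blinfun_apply S (ell2_unit 0)"
    have "blinfun_apply ((weighted_shift a - scalar_op c) o\<^sub>L S) (ell2_unit 0) = ell2_unit 0"
      by (simp add: S)
    then have "blinfun_apply (weighted_shift a) x - c *\<^sub>C x = ell2_unit 0"
      by (simp add: x_def blinfun.diff_left scalar_op.rep_eq)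
    then have nth: "ell2_nth (blinfun_apply (weighted_shift a) x) i - c * ell2_nth x i
        = ell2_nth (ell2_unit 0) i" for i
      by (metis minus_ell2.rep_eq scaleC_ell2.rep_eq)
    have 0: "- (c * ell2_nth x 0) = 1"
      using nth [of 0] by (simp add: bdd ell2_unit.rep_eq)
    have Suc: "complex_of_real (a i) * ell2_nth x i = c * ell2_nth x (Suc i)" for i
      using nth [of "Suc i"] by (simp add: bdd ell2_unit.rep_eq)
    \<comment> \<open>The equation at coordinate 0 excludes \<open>c = 0\<close>, so only the case
      \<open>cmod c < L\<close> remains.\<close>
    have "c \<noteq> 0" "ell2_nth x 0 \<noteq> 0"
      using 0 by auto
    have nz: "ell2_nth x i \<noteq> 0" for i
    proof (induction i)
      case (Suc i)
      then show ?case
        using \<open>\<And>i. complex_of_real (a i) * ell2_nth x i = c * ell2_nth x (Suc i)\<close> [of i] pos [of i]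
        by auto
    qed (fact \<open>ell2_nth x 0 \<noteq> 0\<close>)
    have "eventually (\<lambda>i. cmod c < a i) sequentially"
      using c \<open>c \<noteq> 0\<close> order_tendstoD(1) [OF lim] by blast
    then obtain N where N: "\<And>i. i \<ge> N \<Longrightarrow> cmod c < a i"
      by (auto simp: eventually_sequentially)
    have mono: "cmod (ell2_nth x (Suc i)) \<ge> cmod (ell2_nth x i)" if "i \<ge> N" for i
    proof -
      have "cmod c * cmod (ell2_nth x i) \<le> a i * cmod (ell2_nth x i)"
        using N [OF that] by (intro mult_right_mono) auto
      also have "\<dots> = cmod c * cmod (ell2_nth x (Suc i))"
        using arg_cong [OF Suc [of i], of cmod] pos [of i] by (simp add: norm_mult)
      finally show ?thesis
        using \<open>c \<noteq> 0\<close> by simp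
    qed
    have ge: "cmod (ell2_nth x i) \<ge> cmod (ell2_nth x N)" if "i \<ge> N" for i
      using that
    proof (induction i rule: dec_induct)
      case (step i)
      then show ?case
        using mono [of i] by linarith
    qed simp
    have "(\<lambda>i. (cmod (ell2_nth x i))\<^sup>2) \<longlonglongrightarrow> 0"
      by (rule summable_LIMSEQ_zero) (rule summable_ell2)
    then have "(cmod (ell2_nth x N))\<^sup>2 \<le> 0"
      by (rule LIMSEQ_le_const) (use ge in \<open>auto intro!: exI [of _ N] power_mono\<close>)
    then show False
      using nz [of N] by simp
  qed
  then show ?thesis
    by (auto simp: op_spectrum_def op_invertible_def)
qed

text \<open>
  Conjugating by the diagonal operator with entries \<open>d i\<close>, the partial products of
  \<open>max 1 (a j / \<rho>)\<close>, turns the weights into \<open>a i * d i / d (Suc i) \<le> \<rho>\<close>; as only finitely many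
  weights exceed \<open>\<rho>\<close>, the sequence \<open>d\<close> is bounded.
\<close>

lemma op_spectrum_weighted_shift_le:
  assumes pos: "\<And>i. a i > 0" and lim: "a \<longlonglongrightarrow> L" and c: "c \<in> op_spectrum (weighted_shift a)"
  shows "cmod c \<le> L"
proof (rule ccontr)
  assume "\<not> cmod c \<le> L"
  then obtain \<rho> where \<rho>: "L < \<rho>" "\<rho> < cmod c"
    using dense [of L "cmod c"] by auto
  have "L \<ge> 0"
    using LIMSEQ_le_const [OF lim] pos less_imp_le by blast
  then have "\<rho> > 0"
    using \<rho> by simp
  have bdd: "bounded (range a)"
    using lim by (simp add: convergentI convergent_imp_bounded)
  define d where "d i = (\<Prod>j<i. max 1 (a j / \<rho>))" for i
  have d_Suc: "d (Suc i) = d i * max 1 (a i / \<rho>)" for i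
    by (simp add: d_def)
  have d_ge: "d i \<ge> 1" for i
    by (simp add: d_def prod_ge_1)
  have d_mono: "d i \<le> d (Suc i)" for i
    using d_ge [of i] mult_left_mono [of 1 "max 1 (a i / \<rho>)" "d i"] by (simp add: d_Suc)
  have "eventually (\<lambda>i. a i < \<rho>) sequentially"
    using order_tendstoD(2) [OF lim \<rho>(1)] .
  then obtain N where N: "\<And>i. i \<ge> N \<Longrightarrow> a i < \<rho>"
    by (auto simp: eventually_sequentially)
  have "d i = d N" if "i \<ge> N" for i
    using that
  proof (induction i rule: dec_induct)
    case (step i)
    then have "max 1 (a i / \<rho>) = 1"
      using N [of i] \<open>\<rho> > 0\<close> by simp
    then show ?case
      using step by (simp add: d_Suc)
  qed simp
  \<comment> \<open>The sequence \<open>d\<close> increases and is constant from \<open>N\<close>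
    on, so \<open>d N\<close> is its maximum.\<close>
  then have d_le: "d i \<le> d N" for i
    using lift_Suc_mono_le [of d, OF d_mono, of i N] by (metis nle_le order_refl)
  have bdd_d: "bounded (range d)"
    by (rule bounded_subset [OF bounded_closed_interval [of 1 "d N"]]) (use d_le d_ge in auto)
  have "\<bar>1 / d i\<bar> \<le> 1" for i
    using d_ge [of i] by simp
  then have bdd_inv: "bounded (range (\<lambda>i. 1 / d i))"
    by (auto simp: bounded_iff)
  have d_pos: "d i > 0" for i
    using d_ge [of i] by linarith
  define b where "b i = a i * d i / d (Suc i)" for i
  have b: "\<bar>b i\<bar> \<le> \<rho>" for i
  proof -
    \<comment> \<open>If \<open>a i \<le> \<rho>\<close> the entry 1 of the maximum suffices;
      otherwise the other entry gives equality.\<close>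
    have "a i \<le> \<rho> * max 1 (a i / \<rho>)"
      using \<open>\<rho> > 0\<close> by (simp add: max_def field_simps)
    from mult_right_mono [OF this, of "d i"] have "a i * d i \<le> \<rho> * d (Suc i)"
      using d_pos [of i] by (simp add: d_Suc mult_ac)
    then show ?thesis
      using d_pos [of i] d_pos [of "Suc i"] pos [of i] by (simp add: b_def field_simps)
  qed
  then have bdd_b: "bounded (range b)"
    by (auto simp: bounded_iff)
  let ?D = "diag_op d" and ?E = "diag_op (\<lambda>i. 1 / d i)"
  note nth = diag_op_nth [OF bdd_d] diag_op_nth [OF bdd_inv]
    weighted_shift_nth_0 [OF bdd_b] weighted_shift_nth_Suc [OF bdd_b]
  \<comment> \<open>The modified shift has norm at most \<rho>, which is below
    \<open>cmod c\<close>.\<close>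
  have "op_invertible (weighted_shift b - scalar_op c)"
    using norm_weighted_shift_le [of b \<rho>] b \<rho>
    by (intro op_invertible_diff_scalar_op complex_linear_weighted_shift bdd_b) simp
  then have "op_invertible (?D o\<^sub>L (weighted_shift b - scalar_op c) o\<^sub>L ?E)"
    by (rule op_invertible_similar)
      (use d_pos in \<open>auto intro!: complex_linear_diag_op bdd_d bdd_inv blinfun_eqI ell2_eqI
        simp: nth less_imp_neq [symmetric]\<close>)
  \<comment> \<open>Conjugation restores the weights, as \<open>d (Suc i) * b i / d i = a i\<close>,
    and leaves the scalar operator unchanged.\<close>
  also have "?D o\<^sub>L (weighted_shift b - scalar_op c) o\<^sub>L ?E = weighted_shift a - scalar_op c"
  proof (intro blinfun_eqI ell2_eqI)
    fix x i
    have "complex_of_real (d j) \<noteq> 0" for j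
      using d_pos [of j] by simp
    then show "ell2_nth (blinfun_apply (?D o\<^sub>L (weighted_shift b - scalar_op c) o\<^sub>L ?E) x) i
        = ell2_nth (blinfun_apply (weighted_shift a - scalar_op c) x) i"
      by (cases i) (simp_all add: nth blinfun.diff_left scalar_op.rep_eq minus_ell2.rep_eq
          scaleC_ell2.rep_eq bdd b_def field_simps)
  qed
  finally show False
    using c by (simp add: op_spectrum_def)
qed

section \<open>The spectral radius\<close>

lemma op_spectral_radius_weighted_shift:
  assumes pos: "\<And>i. a i > 0" and lim: "a \<longlonglongrightarrow> L"
  shows "op_spectral_radius (weighted_shift a) = L"
  unfolding op_spectral_radius_def
proof (rule antisym)
  let ?\<sigma> = "op_spectrum (weighted_shift a)"
  note le = op_spectrum_weighted_shift_le [OF assms] and ge = op_spectrum_weighted_shift_ge [OF assms]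
  \<comment> \<open>The conditionally complete supremum can be bounded above only over a nonempty
    spectrum.\<close>
  have "0 \<in> ?\<sigma>"
    by (rule ge) simp
  then show "(SUP c\<in>?\<sigma>. cmod c) \<le> L"
    by (intro cSUP_least le) auto
  have upper: "cmod c \<le> (SUP c\<in>?\<sigma>. cmod c)" if "c \<in> ?\<sigma>" for c
    by (rule cSUP_upper [OF that]) (use le in \<open>auto intro!: bdd_aboveI2\<close>)
  show "L \<le> (SUP c\<in>?\<sigma>. cmod c)"
  \<comment> \<open>Each \<open>t\<close> with \<open>0 \<le> t < L\<close> is itself a spectral
    value; for negative \<open>t\<close> the spectral value 0 is enough, which also covers
    \<open>L = 0\<close>.\<close>
  proof (rule dense_le)
    fix t
    assume "t < L"
    show "t \<le> (SUP c\<in>?\<sigma>. cmod c)"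
    proof (cases "t \<ge> 0")
      case True
      then show ?thesis
        using upper [OF ge, of "complex_of_real t"] \<open>t < L\<close> by simp
    next
      case False
      then show ?thesis
        using upper [OF \<open>0 \<in> ?\<sigma>\<close>] by simp
    qed
  qed
qed

theorem proposition4p6:
  fixes \<alpha> :: "nat \<Rightarrow> real"
  assumes "\<And>i. \<alpha> i > 0"
    and "convergent \<alpha>"
  shows "mean_limit (weighted_shift \<alpha>) = op_spectral_radius (weighted_shift \<alpha>)
    \<and> op_spectral_radius (weighted_shift \<alpha>) = lim \<alpha>"
proof -
  have "\<alpha> \<longlonglongrightarrow> lim \<alpha>"
    using assms(2) by (simp add: convergent_LIMSEQ_iff)
  then show ?thesis
    using mean_limit_weighted_shift op_spectral_radius_weighted_shift assms(1) by metis
qed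

end
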